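(* Let $\phi=(1+\sqrt5)/2$ and let $F_n$ be the Fibonacci numbers, extended to all integer indices. For every positive integer $n$, \[ \tan^{-1} \phi^{4n-1} = 3\tan^{-1}1-\frac{1}{2}\tan^{-1}\frac{1}{2}-\tan^{-1}\left(\frac{F_{2n-1}}{F_{2n}}\right). \] For every non-negative integer $n$, \[ \tan^{-1} \phi^{4n-3} = \tan^{-1}1+\frac{1}{2}\tan^{-1}\frac{1}{2}+\tan^{-1}\left(\frac{F_{2n-2}}{F_{2n-1}}\right). \]
   Context: $\phi=(1+\sqrt5)/2$ is the golden ratio. The Fibonacci numbers are defined by $F_0=0$, $F_1=1$, $F_n=F_{n-1}+F_{n-2}$, and extended to negative indices by the same recurrence, so that $F_{-m}=(-1)^{m+1}F_m$. $\tan^{-1}$ denotes the principal branch of the arctangent, with values in $(-\pi/2,\pi/2)$. *)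

theory Defs
  imports Complex_Main "HOL-Number_Theory.Fib"
begin

definition golden_ratio :: real
  where "golden_ratio = (1 + sqrt 5) / 2"

definition fib_int :: "int \<Rightarrow> int"
  where "fib_int k =
    (if k \<ge> 0 then int (fib (nat k)) else (- 1) ^ (nat (- k) + 1) * int (fib (nat (- k))))"

text \<open>The extension is characterised by the usual initial values together with the Fibonacci
  recurrence at all integers.\<close>

lemma fib_int_0: "fib_int 0 = 0"
  by (simp add: fib_int_def)

lemma fib_int_1: "fib_int 1 = 1"
  by (simp add: fib_int_def)

lemma fib_int_rec: "fib_int k = fib_int (k - 1) + fib_int (k - 2)"
proof -
  consider "k \<ge> 2" | "k = 1" | "k = 0" | "k < 0" by linarith
  then show ?thesis
  proof cases
    case 1
    define m where "m = nat (k - 2)"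
    have "k = int m + 2" using 1 by (simp add: m_def)
    then show ?thesis by (simp add: fib_int_def nat_add_distrib)
  next
    case 4
    define m where "m = nat (- k)"
    have k: "k = - int m" and "m > 0" using 4 by (simp_all add: m_def)
    have n: "nat (- (k - 1)) = Suc m" "nat (- (k - 2)) = Suc (Suc m)"
      using 4 by (simp_all add: m_def)
    show ?thesis using 4 unfolding fib_int_def n by (simp add: m_def [symmetric] algebra_simps)
  qed (simp_all add: fib_int_def)
qed

end

theory Submission
  imports Defs
begin

text \<open>Everything reduces to the tangent addition formula. The half angle is
  \<open>arctan (1/2) / 2 = arctan \<phi> - \<pi>/4\<close>, since doubling \<open>arctan \<phi>\<close> gives
  \<open>arctan \<phi> + arctan \<phi> - \<pi>/2 = arctan \<phi> - arctan (1/\<phi>)\<close>, whose tangent is \<open>1/2\<close>.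
  The addition formula then produces quotients of \<open>\<phi> F k + F (k - 1) = \<phi>^k\<close> and
  \<open>F (k + 1) - \<phi> F k = (1 - \<phi>)^k\<close>, and \<open>(1 - \<phi>)^k = \<phi>^(-k)\<close> up to sign.\<close>

text \<open>The condition \<open>x * y < 1\<close> keeps the sum of the angles inside (-\<pi>/2,
  \<pi>/2), so no multiple of \<pi> has to be added. It leaves room for an argument above 1 such as
  \<phi>.\<close>

lemma arctan_add_mult_less_1:
  assumes "x * y < 1"
  shows "arctan x + arctan y = arctan ((x + y) / (1 - x * y))"
proof -
  let ?s = "arctan x + arctan y"
  have bnd: "- (pi/2) < ?s \<and> ?s < pi/2"
  proof -
    \<comment> \<open>An upper bound suffices: applied to \<open>-x\<close> and \<open>-y\<close>,
      it becomes the lower bound.\<close>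
    have aux: "arctan u + arctan v < pi/2" if "u * v < 1" for u v :: real
    proof (cases "u > 0")
      case True
      with that have "v < 1 / u" by (simp add: field_simps)
      then have "arctan v < arctan (1 / u)" by (simp add: arctan_less_iff)
      also have "\<dots> = pi/2 - arctan u" using True arctan_inverse[of u] by (simp add: sgn_if)
      finally show ?thesis by simp
    next
      case False
      then have "arctan u \<le> 0" by simp
      then show ?thesis using arctan_ubound[of v] by linarith
    qed
    show ?thesis using aux[of x y] aux[of "-x" "-y"] assms by (simp add: arctan_minus)
  qed
  have "cos ?s \<noteq> 0" using bnd cos_gt_zero_pi[of ?s] by force
  then have "tan ?s = (x + y) / (1 - x * y)"
    by (simp add: tan_add tan_arctan)
  then show ?thesis using bnd by (metis arctan_unique)
qed

lemma golden_ratio_pos: "golden_ratio > 0"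
  unfolding golden_ratio_def by (simp add: add_pos_pos)

lemma golden_ratio_gt_1: "golden_ratio > 1"
  unfolding golden_ratio_def by simp

lemma golden_ratio_square: "golden_ratio * golden_ratio = golden_ratio + 1"
  unfolding golden_ratio_def by (simp add: field_simps)

lemma inverse_golden_ratio: "inverse golden_ratio = golden_ratio - 1"
  using golden_ratio_square golden_ratio_pos by (simp add: field_simps)

text \<open>Induction in both directions from 0: a factor \<phi>, reduced by \<phi>^2 = \<phi> + 1,
  shifts the pair of Fibonacci coefficients up; a factor 1/\<phi> = \<phi> - 1 shifts it
  down.\<close>

lemma golden_ratio_powi:
  "golden_ratio powi k = golden_ratio * fib_int k + fib_int (k - 1)"
proof (induction k rule: int_induct[where k = 0])
  case base
  have "fib_int (-1) = 1" by (simp add: fib_int_def)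
  then show ?case by (simp add: fib_int_0)
next
  case (step1 i)
  have "golden_ratio powi (i + 1) = golden_ratio * golden_ratio powi i"
    using golden_ratio_pos by (simp add: power_int_add)
  also have "\<dots> = (golden_ratio * golden_ratio) * fib_int i + golden_ratio * fib_int (i - 1)"
    by (simp add: step1 algebra_simps)
  finally show ?case
    using fib_int_rec[of "i + 1"] by (simp add: golden_ratio_square algebra_simps)
next
  case (step2 i)
  have "golden_ratio powi (i - 1) = inverse golden_ratio * golden_ratio powi i"
    using golden_ratio_pos by (simp add: power_int_diff field_simps)
  also have "\<dots> = (golden_ratio * golden_ratio - golden_ratio) * fib_int i
      + (golden_ratio - 1) * fib_int (i - 1)"
    by (simp add: step2 inverse_golden_ratio algebra_simps)
  finally show ?case
    using fib_int_rec[of i] by (simp add: golden_ratio_square algebra_simps)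
qed

text \<open>The same induction works because 1 - \<phi> is the other root of x^2 = x + 1. At
  \<open>k - 1\<close> the right-hand side is the denominator that the addition formula produces, up
  to sign.\<close>

lemma conjugate_golden_ratio_powi:
  "(1 - golden_ratio) powi k = fib_int (k + 1) - golden_ratio * fib_int k"
proof (induction k rule: int_induct[where k = 0])
  case base
  then show ?case by (simp add: fib_int_0 fib_int_1)
next
  case (step1 i)
  have "(1 - golden_ratio) powi (i + 1) = (1 - golden_ratio) * (1 - golden_ratio) powi i"
    using golden_ratio_gt_1 by (simp add: power_int_add)
  also have "\<dots> = (1 - golden_ratio) * fib_int (i + 1)
      + (golden_ratio * golden_ratio - golden_ratio) * fib_int i"
    by (simp add: step1 algebra_simps)
  finally show ?case
    using fib_int_rec[of "i + 2"] by (simp add: golden_ratio_square algebra_simps)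
next
  case (step2 i)
  have inv: "inverse (1 - golden_ratio) = - golden_ratio"
    using golden_ratio_square golden_ratio_gt_1 by (simp add: field_simps)
  have "(1 - golden_ratio) powi (i - 1) = inverse (1 - golden_ratio) * (1 - golden_ratio) powi i"
    using golden_ratio_gt_1 by (simp add: power_int_diff field_simps)
  also have "\<dots> = (golden_ratio * golden_ratio) * fib_int i - golden_ratio * fib_int (i + 1)"
    by (simp add: step2 inv algebra_simps)
  finally show ?case
    using fib_int_rec[of "i + 1"] by (simp add: golden_ratio_square algebra_simps)
qed

text \<open>Because 1 - \<phi> = -1/\<phi>, the parity of the index fixes the sign of that
  denominator. This is what separates the odd and even cases below.\<close>

lemma conjugate_golden_ratio_powi_eq:
  "(1 - golden_ratio) powi k = (if even k then 1 else - 1) * golden_ratio powi (- k)"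
proof -
  have "1 - golden_ratio = - inverse golden_ratio" by (simp add: inverse_golden_ratio)
  then show ?thesis by (simp add: power_int_minus_left power_int_minus power_int_inverse)
qed

lemma half_arctan_half: "1 / 2 * arctan (1 / 2) = arctan golden_ratio - arctan 1"
proof -
  have p: "golden_ratio * - inverse golden_ratio = - 1" using golden_ratio_pos by simp
  \<comment> \<open>The numerator is \<phi> - (\<phi> - 1) = 1 and the denominator is 1 - (-1) =
    2.\<close>
  have "arctan golden_ratio + arctan (- inverse golden_ratio) = arctan (1 / 2)"
    using arctan_add_mult_less_1[of golden_ratio "- inverse golden_ratio"]
    unfolding p by (simp add: inverse_golden_ratio)
  moreover have "arctan (inverse golden_ratio) = pi / 2 - arctan golden_ratio"
    using arctan_inverse[of golden_ratio] golden_ratio_pos by (simp add: inverse_eq_divide)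
  ultimately show ?thesis by (simp add: arctan_minus arctan_one)
qed

text \<open>At a negative odd index the sign factor has an even exponent. The case
  \<open>k = -1\<close> occurs in the second identity at \<open>n = 0\<close>.\<close>

lemma fib_int_odd_pos:
  assumes "odd k"
  shows "fib_int k > 0"
proof -
  have "k \<noteq> 0" using assms by auto
  then show ?thesis using assms by (auto simp: fib_int_def even_nat_iff intro!: fib_neq_0_nat)
qed

lemma arctan_golden_ratio_powi_odd:
  assumes "odd k"
  shows "arctan (golden_ratio powi (2 * k - 1)) =
    arctan golden_ratio + arctan (fib_int (k - 1) / fib_int k)"
proof -
  let ?g = golden_ratio and ?a = "real_of_int (fib_int k)" and ?b = "real_of_int (fib_int (k - 1))"
  have a: "?a > 0" using fib_int_odd_pos[OF assms] by simp
  have num: "?g * ?a + ?b = ?g powi k" by (simp add: golden_ratio_powi)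
  \<comment> \<open>Here \<open>k - 1\<close> is even, so the conjugate power is positive; this
    gives the product condition of the addition formula.\<close>
  have den: "?a - ?g * ?b = ?g powi (1 - k)"
    using conjugate_golden_ratio_powi[of "k - 1"] conjugate_golden_ratio_powi_eq[of "k - 1"] assms
    by simp
  have "?a - ?g * ?b > 0" unfolding den using golden_ratio_pos by simp
  then have "?g * (?b / ?a) < 1" using a by (simp add: field_simps)
  moreover have "(?g + ?b / ?a) / (1 - ?g * (?b / ?a)) = (?g * ?a + ?b) / (?a - ?g * ?b)"
    using a \<open>?a - ?g * ?b > 0\<close> by (simp add: divide_simps)
  moreover have "?g powi k / ?g powi (1 - k) = ?g powi (2 * k - 1)"
    using golden_ratio_pos by (simp flip: power_int_diff)
  ultimately show ?thesis
    using arctan_add_mult_less_1[of ?g "?b / ?a"] by (simp only: num den)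
qed

text \<open>For even positive \<open>k\<close> the product of \<phi> and
  \<open>fib_int (k - 1) / fib_int k\<close> exceeds 1. The addition formula is therefore applied to
  the reciprocals, and each reciprocal contributes \<pi>/2 to the constant \<pi>.\<close>

lemma arctan_golden_ratio_powi_even:
  assumes "even k" "k > 0"
  shows "arctan (golden_ratio powi (2 * k - 1)) =
    pi - arctan golden_ratio - arctan (fib_int (k - 1) / fib_int k)"
proof -
  let ?g = golden_ratio and ?a = "real_of_int (fib_int k)" and ?b = "real_of_int (fib_int (k - 1))"
  have a: "?a > 0" using assms by (simp add: fib_int_def fib_neq_0_nat)
  have b: "?b > 0" using fib_int_odd_pos[of "k - 1"] assms by simp
  have num: "?g * ?a + ?b = ?g powi k" by (simp add: golden_ratio_powi)
  have den: "?g * ?b - ?a = ?g powi (1 - k)"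
    using conjugate_golden_ratio_powi[of "k - 1"] conjugate_golden_ratio_powi_eq[of "k - 1"] assms
    by simp
  have pos: "?g * ?b - ?a > 0" unfolding den using golden_ratio_pos by simp
  then have "1 / ?g * (?a / ?b) < 1" using b golden_ratio_pos by (simp add: field_simps)
  moreover have "(1 / ?g + ?a / ?b) / (1 - 1 / ?g * (?a / ?b)) = (?g * ?a + ?b) / (?g * ?b - ?a)"
    using b pos golden_ratio_pos by (simp add: divide_simps)
  moreover have "?g powi k / ?g powi (1 - k) = ?g powi (2 * k - 1)"
    using golden_ratio_pos by (simp flip: power_int_diff)
  ultimately have "arctan (?g powi (2 * k - 1)) = arctan (1 / ?g) + arctan (?a / ?b)"
    using arctan_add_mult_less_1[of "1 / ?g" "?a / ?b"] by (simp only: num den)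
  then show ?thesis
    using arctan_inverse[of ?g] arctan_inverse[of "?b / ?a"] golden_ratio_pos a b by simp
qed

theorem theorem3:
  shows "(\<forall>n::int. n > 0 \<longrightarrow>
      arctan (golden_ratio powi (4 * n - 1)) =
        3 * arctan 1 - 1 / 2 * arctan (1 / 2)
          - arctan (real_of_int (fib_int (2 * n - 1)) / real_of_int (fib_int (2 * n))))
    \<and> (\<forall>n::int. n \<ge> 0 \<longrightarrow>
      arctan (golden_ratio powi (4 * n - 3)) =
        arctan 1 + 1 / 2 * arctan (1 / 2)
          + arctan (real_of_int (fib_int (2 * n - 2)) / real_of_int (fib_int (2 * n - 1))))"
proof (intro conjI allI impI)
  fix n :: int
  assume "n > 0"
  then show "arctan (golden_ratio powi (4 * n - 1)) = 3 * arctan 1 - 1 / 2 * arctan (1 / 2)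
      - arctan (real_of_int (fib_int (2 * n - 1)) / real_of_int (fib_int (2 * n)))"
    \<comment> \<open>With the half angle inserted, the four copies of \<open>arctan 1\<close> add
      up to \<pi>.\<close>
    using arctan_golden_ratio_powi_even[of "2 * n"] unfolding half_arctan_half
    by (simp add: arctan_one)
next
  fix n :: int
  show "arctan (golden_ratio powi (4 * n - 3)) = arctan 1 + 1 / 2 * arctan (1 / 2)
      + arctan (real_of_int (fib_int (2 * n - 2)) / real_of_int (fib_int (2 * n - 1)))"
    \<comment> \<open>With the half angle inserted, the two copies of \<open>arctan 1\<close> cancel
      and leave \<open>arctan golden_ratio\<close>.\<close>
    using arctan_golden_ratio_powi_odd[of "2 * n - 1"] unfolding half_arctan_half by simp
qed

end
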